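(* Let $g(n,1)$ denote the number of permutations $\pi\in S_n$ such that $\gamma(G_\pi)=1$, and for $m\ge 0$ let $f(m,1,0)=m!-g(m,1)$. Then $g(0,1)=0$ and, for every $n\ge 1$, \[ g(n,1)=\sum_{k=1}^{n}(n-k)!\,f(k-1,1,0). \]
   Context: For a permutation $\pi$ of $[n]=\{1,\dots,n\}$ (written in one-line notation $[\pi(1),\dots,\pi(n)]$), the permutation graph $G_\pi$ has vertex set $[n]$ and an edge between $i<j$ if and only if $\pi^{-1}(i)>\pi^{-1}(j)$. A set $D$ of vertices dominates a graph $G$ if every vertex is in $D$ or adjacent to a vertex of $D$; the domination number $\gamma(G)$ is the minimum size of a dominating set. Counts of "permutation graphs on $n$ vertices" with a property are counts of permutations $\pi\in S_n$ whose graph $G_\pi$ has that property. Thus $f(m,1,0)$ is the number of $\pi\in S_m$ such that $G_\pi$ has no dominating set of size one (with $f(0,1,0)=1$). *)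

theory Defs
  imports "HOL-Combinatorics.Permutations"
begin

text \<open>A graph is given by its vertex set \<open>V\<close> and its set \<open>E\<close> of two-element edges.\<close>

definition perm_graph_edges :: "nat \<Rightarrow> (nat \<Rightarrow> nat) \<Rightarrow> nat set set" where
  "perm_graph_edges n p =
     {{i, j} | i j. i \<in> {1..n} \<and> j \<in> {1..n} \<and> i < j \<and> inv p i > inv p j}"

definition dominates :: "'a set \<Rightarrow> 'a set set \<Rightarrow> 'a set \<Rightarrow> bool" where
  "dominates V E D \<longleftrightarrow> D \<subseteq> V \<and> (\<forall>v\<in>V. v \<in> D \<or> (\<exists>d\<in>D. {v, d} \<in> E))"

text \<open>Meant for finite graphs, where \<open>V\<close> itself dominates, so the minimum exists.
  The graph without vertices has domination number 0.\<close>

definition domination_number :: "'a set \<Rightarrow> 'a set set \<Rightarrow> nat" where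
  "domination_number V E = (LEAST k. \<exists>D. finite D \<and> dominates V E D \<and> card D = k)"

definition g :: "nat \<Rightarrow> nat \<Rightarrow> nat" where
  "g n k = card {p. p permutes {1..n} \<and> domination_number {1..n} (perm_graph_edges n p) = k}"

text \<open>\<open>f10 m\<close> stands for $f(m,1,0)$; it is integer-valued so that the subtraction is
  not truncated.\<close>

definition f10 :: "nat \<Rightarrow> int" where
  "f10 m = fact m - int (g m 1)"

end

theory Submission
  imports Defs
begin

text \<open>
  A vertex \<open>v\<close> dominates the permutation graph of \<open>p\<close> iff \<open>inv p\<close> reverses the order of \<open>v\<close> with
  respect to every other vertex. Composing \<open>inv p\<close> with the reversal of \<open>{1..n}\<close> therefore turns
  dominating vertices into strong fixed points, i.e. fixed points \<open>v\<close> such that the set of numbers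
  below \<open>v\<close> is invariant. A permutation of \<open>{1..n}\<close> with least strong fixed point \<open>k\<close> splits
  uniquely into a permutation of \<open>{1..<k}\<close> without strong fixed points and an arbitrary
  permutation of \<open>{k+1..n}\<close>.
\<close>

section \<open>Strong fixed points and order reversal\<close>

text \<open>No bound \<open>n\<close> occurs, so the notion passes unchanged between permutations of
  \<open>{1..n}\<close> and of \<open>{1..k-1}\<close>. Every such permutation has 0 as a strong
  fixed point, which is why \<open>v\<close> is always taken from a range starting at 1.\<close>

definition strong_fixpoint :: "(nat \<Rightarrow> nat) \<Rightarrow> nat \<Rightarrow> bool" where
  "strong_fixpoint r v \<longleftrightarrow> r v = v \<and> (\<forall>i<v. r i < v)"

definition reversal :: "nat \<Rightarrow> nat \<Rightarrow> nat" where
  "reversal n i = (if i \<in> {1..n} then n + 1 - i else i)"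

lemma reversal_reversal [simp]: "reversal n (reversal n i) = i"
  by (auto simp: reversal_def)

lemma reversal_comp_reversal [simp]: "reversal n \<circ> reversal n = id"
  by auto

lemma reversal_permutes: "reversal n permutes {1..n}"
proof (rule bij_imp_permutes)
  show "bij_betw (reversal n) {1..n} {1..n}"
    by (rule bij_betw_byWitness[where f' = "reversal n"]) (auto simp: reversal_def)
qed (auto simp: reversal_def)

lemma reversal_less_iff:
  "i \<in> {1..n} \<Longrightarrow> j \<in> {1..n} \<Longrightarrow> reversal n i < reversal n j \<longleftrightarrow> j < i"
  by (auto simp: reversal_def)

text \<open>An injective self-map of a finite set is onto. This is what cuts a permutation into its
  blocks below and above a strong fixed point.\<close>

lemma permutes_restrict_invariant:
  assumes "r permutes T" "finite S" "r ` S \<subseteq> S"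
  shows "(\<lambda>i. if i \<in> S then r i else i) permutes S"
proof (rule bij_imp_permutes)
  have inj: "inj_on r S"
    using permutes_inj[OF assms(1)] by (rule inj_on_subset) simp
  then have "bij_betw r S S"
    using endo_inj_surj[OF assms(2,3) inj] by (simp add: bij_betw_def)
  then show "bij_betw (\<lambda>i. if i \<in> S then r i else i) S S"
    by (subst bij_betw_cong[where g = r]) auto
qed auto

text \<open>The finite set \<open>{..v}\<close> is mapped into itself, hence onto itself by
  injectivity, so its values are all taken and \<open>r j\<close> must lie above
  \<open>v\<close>.\<close>

lemma strong_fixpoint_greater:
  assumes "inj r" "strong_fixpoint r v" "v < j"
  shows "v < r j"
proof -
  have "r ` {..v} \<subseteq> {..v}"
    using assms(2) by (fastforce simp: strong_fixpoint_def le_less)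
  moreover have "inj_on r {..v}"
    using assms(1) by (rule inj_on_subset) simp
  ultimately have "r ` {..v} = {..v}"
    by (simp add: endo_inj_surj)
  moreover have "r j \<notin> r ` {..v}"
    using assms(1,3) by (auto simp: inj_image_mem_iff)
  ultimately show ?thesis by auto
qed

lemma strong_fixpoint_iff:
  assumes r: "r permutes {1..n}" and v: "v \<in> {1..n}"
  shows "strong_fixpoint r v \<longleftrightarrow>
    (\<forall>i\<in>{1..n}. (i < v \<longrightarrow> r i < r v) \<and> (v < i \<longrightarrow> r v < r i))"
    (is "_ \<longleftrightarrow> ?mono")
proof
  assume sf: "strong_fixpoint r v"
  then show ?mono
    using strong_fixpoint_greater[OF permutes_inj[OF r] sf] by (auto simp: strong_fixpoint_def)
next
  assume mono: ?mono
  have inj: "inj_on r A" for A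
    using permutes_inj[OF r] by (rule inj_on_subset) simp
  have mem: "r i \<in> {1..n} \<longleftrightarrow> i \<in> {1..n}" for i
    using r by (rule permutes_in_image)
  have lower: "r ` {1..<v} \<subseteq> {1..<r v}"
  proof
    fix y assume "y \<in> r ` {1..<v}"
    then obtain i where i: "y = r i" "i \<in> {1..<v}" by auto
    then show "y \<in> {1..<r v}"
      using mono v mem[of i] by auto
  qed
  have upper: "r ` {v<..n} \<subseteq> {r v<..n}"
  proof
    fix y assume "y \<in> r ` {v<..n}"
    then obtain i where i: "y = r i" "i \<in> {v<..n}" by auto
    then show "y \<in> {r v<..n}"
      using mono v mem[of i] by auto
  qed
  \<comment> \<open>Injectivity fits the \<open>v - 1\<close> smaller points below
    \<open>r v\<close> and the \<open>n - v\<close> larger ones above it; the two bounds pin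
    \<open>r v\<close> to \<open>v\<close>.\<close>
  have "v - 1 \<le> r v - 1"
    using card_inj_on_le[OF inj lower] by simp
  moreover have "n - v \<le> n - r v"
    using card_inj_on_le[OF inj upper] by simp
  ultimately have fix_v: "r v = v"
    using v mem[of v] by auto
  \<comment> \<open>The definition also quantifies over \<open>i = 0\<close>, which
    \<open>mono\<close> does not cover; \<open>r\<close> fixes it.\<close>
  have "r i < v" if "i < v" for i
  proof (cases "i = 0")
    case True
    then show ?thesis using permutes_not_in[OF r, of 0] v by simp
  next
    case False
    then show ?thesis using mono that v fix_v by auto
  qed
  then show "strong_fixpoint r v"
    using fix_v by (simp add: strong_fixpoint_def)
qed

section \<open>Graphs with domination number one\<close>

lemma domination_number_eq_1_iff:
  assumes "finite V"
  shows "domination_number V E = 1 \<longleftrightarrow> (\<exists>v\<in>V. \<forall>u\<in>V. u \<noteq> v \<longrightarrow> {u, v} \<in> E)"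
    (is "_ \<longleftrightarrow> ?dom")
proof -
  let ?P = "\<lambda>k. \<exists>D. finite D \<and> dominates V E D \<and> card D = k"
  have P0: "?P 0 \<longleftrightarrow> V = {}"
    unfolding dominates_def by (metis card_0_eq card.empty empty_iff empty_subsetI ex_in_conv finite.emptyI)
  have single: "dominates V E {v} \<longleftrightarrow> v \<in> V \<and> (\<forall>u\<in>V. u \<noteq> v \<longrightarrow> {u, v} \<in> E)" for v
    unfolding dominates_def by blast
  have "?P 1 \<longleftrightarrow> (\<exists>v. dominates V E {v})"
  proof
    assume "?P 1"
    then obtain D where "dominates V E D" "card D = 1" by blast
    then show "\<exists>v. dominates V E {v}" by (metis card_1_singletonE)
  next
    assume "\<exists>v. dominates V E {v}"
    then obtain v where "dominates V E {v}" ..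
    then show "?P 1" by (intro exI[of _ "{v}"]) simp
  qed
  then have P1: "?P 1 \<longleftrightarrow> ?dom"
    unfolding single by blast
  \<comment> \<open>\<open>LEAST\<close> is informative only if some size is attained; the finite
    set \<open>V\<close> dominates itself.\<close>
  have ex: "?P (card V)"
    using assms unfolding dominates_def by blast
  show ?thesis
  proof
    assume "domination_number V E = 1"
    then show ?dom
      using LeastI[of ?P, OF ex] P1 by (simp add: domination_number_def)
  next
    assume dom: ?dom
    then have "\<not> ?P 0" using P0 by auto
    then have "1 \<le> k" if "?P k" for k
      using that by (cases "k = 0") (blast, simp)
    then show "domination_number V E = 1"
      unfolding domination_number_def using dom P1 by (intro Least_equality) blast+
  qed
qed

lemma perm_graph_edge_iff:
  "{u, v} \<in> perm_graph_edges n p \<longleftrightarrow> u \<in> {1..n} \<and> v \<in> {1..n} \<and>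
     (u < v \<and> inv p u > inv p v \<or> v < u \<and> inv p v > inv p u)"
  unfolding perm_graph_edges_def by (auto simp: doubleton_eq_iff)

lemma domination_number_perm_graph_eq_1_iff:
  assumes p: "p permutes {1..n}"
  shows "domination_number {1..n} (perm_graph_edges n p) = 1 \<longleftrightarrow>
    (\<exists>v\<in>{1..n}. strong_fixpoint (reversal n \<circ> inv p) v)"
proof -
  have ip: "inv p permutes {1..n}"
    using p by (rule permutes_inv)
  have r: "reversal n \<circ> inv p permutes {1..n}"
    using ip reversal_permutes by (rule permutes_compose)
  have mem: "inv p i \<in> {1..n} \<longleftrightarrow> i \<in> {1..n}" for i
    using ip by (rule permutes_in_image)
  have "(\<forall>u\<in>{1..n}. u \<noteq> v \<longrightarrow> {u, v} \<in> perm_graph_edges n p) \<longleftrightarrow>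
    strong_fixpoint (reversal n \<circ> inv p) v" if v: "v \<in> {1..n}" for v
    unfolding strong_fixpoint_iff[OF r v]
  proof (rule ball_cong[OF refl])
    fix u assume u: "u \<in> {1..n}"
    \<comment> \<open>For \<open>u\<close> distinct from \<open>v\<close>, both sides say that
      \<open>inv p\<close> reverses their order: on the right, \<open>reversal n\<close> turns each
      comparison around.\<close>
    show "(u \<noteq> v \<longrightarrow> {u, v} \<in> perm_graph_edges n p) \<longleftrightarrow>
      (u < v \<longrightarrow> (reversal n \<circ> inv p) u < (reversal n \<circ> inv p) v) \<and>
      (v < u \<longrightarrow> (reversal n \<circ> inv p) v < (reversal n \<circ> inv p) u)"
      using u v mem[of u] mem[of v]
      by (simp only: perm_graph_edge_iff o_apply reversal_less_iff) (metis not_less_iff_gr_or_eq)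
  qed
  then show ?thesis
    unfolding domination_number_eq_1_iff[OF finite_atLeastAtMost] by (rule bex_cong[OF refl])
qed

section \<open>Counting by strong fixed points\<close>

lemma g_1_eq_card_strong_fixpoint:
  "g n 1 = card {r. r permutes {1..n} \<and> (\<exists>v\<in>{1..n}. strong_fixpoint r v)}" (is "_ = card ?A")
proof -
  let ?D = "{p. p permutes {1..n} \<and> domination_number {1..n} (perm_graph_edges n p) = 1}"
  \<comment> \<open>These maps are mutually inverse because \<open>reversal n\<close> is an
    involution.\<close>
  let ?F = "\<lambda>p. reversal n \<circ> inv p" and ?G = "\<lambda>r. inv (reversal n \<circ> r)"
  have F: "?F p permutes {1..n}" if "p permutes {1..n}" for p
    using permutes_inv[OF that] reversal_permutes by (rule permutes_compose)
  have G: "?G r permutes {1..n}" if "r permutes {1..n}" for r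
    by (intro permutes_inv permutes_compose[OF that] reversal_permutes)
  have GF: "?G (?F p) = p" if "p permutes {1..n}" for p
    using that by (simp add: o_assoc permutes_inv_inv)
  have FG: "?F (?G r) = r" if "r permutes {1..n}" for r
    using permutes_inv_inv[OF permutes_compose[OF that reversal_permutes]] by (simp add: o_assoc)
  have "bij_betw ?F ?D ?A"
  proof (rule bij_betw_byWitness[where f' = ?G])
    show "?F ` ?D \<subseteq> ?A"
      using F domination_number_perm_graph_eq_1_iff by blast
    show "?G ` ?A \<subseteq> ?D"
      using G FG by (auto simp only: mem_Collect_eq domination_number_perm_graph_eq_1_iff image_iff)
  qed (use GF FG in auto)
  then show ?thesis
    by (simp add: g_def bij_betw_same_card)
qed

lemma f10_eq_card_no_strong_fixpoint:
  "f10 m = int (card {r. r permutes {1..m} \<and> (\<forall>v\<in>{1..m}. \<not> strong_fixpoint r v)})"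
    (is "_ = int (card ?B)")
proof -
  let ?A = "{r. r permutes {1..m} \<and> (\<exists>v\<in>{1..m}. strong_fixpoint r v)}"
  have fin: "finite {r. r permutes {1..m}}"
    by (simp add: finite_permutations)
  have "fact m = card {r. r permutes {1..m}}"
    using card_permutations[of "{1..m}" m] by simp
  also have "\<dots> = card (?A \<union> ?B)"
    by (rule arg_cong[where f = card]) auto
  also have "\<dots> = card ?A + card ?B"
    by (rule card_Un_disjoint) (auto intro: finite_subset[OF _ fin])
  finally have "int (fact m) = int (card ?A) + int (card ?B)"
    by simp
  then show ?thesis
    unfolding f10_def g_1_eq_card_strong_fixpoint by simp
qed

section \<open>Splitting at the least strong fixed point\<close>

lemma card_least_strong_fixpoint:
  assumes k: "k \<in> {1..n}"
  shows "card {r. r permutes {1..n} \<and> strong_fixpoint r k \<and> (\<forall>v\<in>{1..<k}. \<not> strong_fixpoint r v)} =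
    fact (n - k) * card {s. s permutes {1..k-1} \<and> (\<forall>v\<in>{1..k-1}. \<not> strong_fixpoint s v)}"
    (is "card ?L = _ * card ?B")
proof -
  let ?T = "{t. t permutes {k<..n}}"
  \<comment> \<open>The factors move disjoint blocks, so composition glues them; \<open>?G\<close>
    cuts the result again by restricting it to each block.\<close>
  let ?F = "\<lambda>(s, t). s \<circ> t :: nat \<Rightarrow> nat"
  let ?G = "\<lambda>r. (\<lambda>i. if i \<in> {1..k-1} then r i else i, \<lambda>i. if i \<in> {k<..n} then r i else i :: nat)"
  \<comment> \<open>Each factor is the identity on the other's block. The index \<open>k\<close>
    falls to \<open>t\<close>, which fixes it.\<close>
  have comp: "(s \<circ> t) i = (if i < k then s i else t i)"
    if s: "s permutes {1..k-1}" and t: "t permutes {k<..n}" for s t i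
  proof (cases "i \<in> {k<..n}")
    case True
    then have "t i \<in> {k<..n}"
      using permutes_in_image[OF t] by blast
    then have "t i \<notin> {1..k-1}"
      by auto
    then show ?thesis
      using True permutes_not_in[OF s, of "t i"] by simp
  next
    case False
    then show ?thesis
      using permutes_not_in[OF t, of i] permutes_not_in[OF s, of i] k by auto
  qed
  have "bij_betw ?F (?B \<times> ?T) ?L"
  proof (rule bij_betw_byWitness[where f' = ?G])
    show "\<forall>x\<in>?B \<times> ?T. ?G (?F x) = x"
    proof
      fix x assume "x \<in> ?B \<times> ?T"
      then obtain s t where x: "x = (s, t)"
        and s: "s permutes {1..k-1}" and t: "t permutes {k<..n}" by blast
      have "(if i \<in> {1..k-1} then (s \<circ> t) i else i) = s i" for i
        using comp[OF s t, of i] permutes_not_in[OF s, of i] by auto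
      moreover have "(if i \<in> {k<..n} then (s \<circ> t) i else i) = t i" for i
        using comp[OF s t, of i] permutes_not_in[OF t, of i] by auto
      ultimately show "?G (?F x) = x" by (simp only: x prod.case)
    qed
    show "?F ` (?B \<times> ?T) \<subseteq> ?L"
    proof (rule image_subsetI)
      fix x assume "x \<in> ?B \<times> ?T"
      then obtain s t where x: "x = (s, t)"
        and s: "s permutes {1..k-1}" and t: "t permutes {k<..n}"
        and no: "\<forall>v\<in>{1..k-1}. \<not> strong_fixpoint s v" by blast
      have "s permutes {1..n}" "t permutes {1..n}"
        by (rule permutes_subset[OF s], use k in force, rule permutes_subset[OF t], force)
      then have perm: "s \<circ> t permutes {1..n}"
        by (rule permutes_compose[rotated])
      have "s i < k" if "i < k" for i
        using that k permutes_in_image[OF s, of i] permutes_not_in[OF s, of i]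
        by (cases "i \<in> {1..k-1}") auto
      moreover have "t k = k"
        using permutes_not_in[OF t, of k] by simp
      ultimately have "strong_fixpoint (s \<circ> t) k"
        by (simp only: strong_fixpoint_def comp[OF s t]) simp
      \<comment> \<open>Being a strong fixed point at \<open>v\<close> depends only on values at
        indices up to \<open>v\<close>, where the composite agrees with \<open>s\<close>.\<close>
      moreover have "strong_fixpoint (s \<circ> t) v \<longleftrightarrow> strong_fixpoint s v" if "v < k" for v
        using that by (simp only: strong_fixpoint_def comp[OF s t]) auto
      ultimately show "?F x \<in> ?L"
        using perm no by (auto simp: x simp del: o_apply)
    qed
    have G: "fst (?G r) permutes {1..k-1} \<and> snd (?G r) permutes {k<..n}"
      if r: "r permutes {1..n}" and sf: "strong_fixpoint r k" for r
    proof -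
      have mem: "r i \<in> {1..n} \<longleftrightarrow> i \<in> {1..n}" for i
        using r by (rule permutes_in_image)
      have "r ` {1..k-1} \<subseteq> {1..k-1}"
      proof (rule image_subsetI)
        fix i assume "i \<in> {1..k-1}"
        then have "r i < k" "r i \<in> {1..n}"
          using sf k mem[of i] by (auto simp: strong_fixpoint_def)
        then show "r i \<in> {1..k-1}" by auto
      qed
      moreover have "r ` {k<..n} \<subseteq> {k<..n}"
      proof (rule image_subsetI)
        fix i assume "i \<in> {k<..n}"
        then show "r i \<in> {k<..n}"
          using strong_fixpoint_greater[OF permutes_inj[OF r] sf, of i] mem[of i] by auto
      qed
      ultimately show ?thesis
        unfolding fst_conv snd_conv by (intro conjI permutes_restrict_invariant[OF r]) auto
    qed
    show "\<forall>r\<in>?L. ?F (?G r) = r"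
    proof
      fix r assume "r \<in> ?L"
      then have r: "r permutes {1..n}" and sf: "strong_fixpoint r k" by blast+
      have "(fst (?G r) \<circ> snd (?G r)) i = r i" for i
      proof -
        have "(fst (?G r) \<circ> snd (?G r)) i = (if i < k then fst (?G r) i else snd (?G r) i)"
          using G[OF r sf] by (intro comp) blast+
        also have "\<dots> = r i"
          \<comment> \<open>Where both restrictions take their default \<open>i\<close>, namely at
            0, at \<open>k\<close> and beyond \<open>n\<close>, \<open>r\<close> fixes
            \<open>i\<close> as well.\<close>
          using permutes_not_in[OF r, of i] sf k
          by (cases i k rule: linorder_cases) (auto simp: strong_fixpoint_def)
        finally show ?thesis .
      qed
      then show "?F (?G r) = r"
        unfolding fst_conv snd_conv prod.case by (rule ext)
    qed
    show "?G ` ?L \<subseteq> ?B \<times> ?T"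
    proof (rule image_subsetI)
      fix r assume "r \<in> ?L"
      then have r: "r permutes {1..n}" and sf: "strong_fixpoint r k"
        and no: "\<forall>v\<in>{1..<k}. \<not> strong_fixpoint r v" by auto
      \<comment> \<open>The agreement includes \<open>i = 0\<close>, outside the block but fixed by
        \<open>r\<close>; hence strong fixed points below \<open>k\<close> are the same for
        both.\<close>
      have "fst (?G r) i = r i" if "i < k" for i
        using that permutes_not_in[OF r, of 0] by (cases "i = 0") auto
      then have "strong_fixpoint (fst (?G r)) v \<longleftrightarrow> strong_fixpoint r v" if "v < k" for v
        using that by (simp only: strong_fixpoint_def) auto
      then have "\<forall>v\<in>{1..k-1}. \<not> strong_fixpoint (fst (?G r)) v"
        using no k by auto
      then show "?G r \<in> ?B \<times> ?T"
        using G[OF r sf] unfolding mem_Times_iff mem_Collect_eq by blast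
    qed
  qed
  then have "card ?L = card ?B * card ?T"
    by (simp add: bij_betw_same_card[symmetric] card_cartesian_product)
  also have "card ?T = fact (n - k)"
    by (rule card_permutations) simp_all
  finally show ?thesis by (simp add: mult.commute)
qed

theorem theorem1:
  "g 0 1 = 0 \<and>
   (\<forall>n\<ge>1. int (g n 1) = (\<Sum>k=1..n. fact (n - k) * f10 (k - 1)))"
proof (intro conjI allI impI)
  show "g 0 1 = 0"
    unfolding g_1_eq_card_strong_fixpoint by simp
next
  fix n :: nat
  let ?L = "\<lambda>k. {r. r permutes {1..n} \<and> strong_fixpoint r k \<and> (\<forall>v\<in>{1..<k}. \<not> strong_fixpoint r v)}"
  have fin: "finite {r. r permutes {1..n}}"
    by (simp add: finite_permutations)
  have "{r. r permutes {1..n} \<and> (\<exists>v\<in>{1..n}. strong_fixpoint r v)} = (\<Union>k\<in>{1..n}. ?L k)"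
    (is "?A = ?U")
  proof
    show "?A \<subseteq> ?U"
    proof
      fix r assume "r \<in> ?A"
      then obtain v where r: "r permutes {1..n}" and v: "v \<in> {1..n}" "strong_fixpoint r v"
        by blast
      \<comment> \<open>Membership in \<open>{1..n}\<close> is part of \<open>?P\<close> because the
        least strong fixed point of \<open>r\<close> would otherwise be 0.\<close>
      let ?P = "\<lambda>v. v \<in> {1..n} \<and> strong_fixpoint r v"
      have k: "?P (Least ?P)"
        using v by (intro LeastI[of ?P v]) blast
      have "\<not> strong_fixpoint r u" if u: "u \<in> {1..<Least ?P}" for u
      proof -
        have "\<not> ?P u"
          using u by (intro not_less_Least) simp
        moreover have "u \<in> {1..n}"
          using u k by simp
        ultimately show ?thesis by blast
      qed
      then show "r \<in> ?U" using r k by blast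
    qed
  qed auto
  then have "g n 1 = card ?U"
    by (simp only: g_1_eq_card_strong_fixpoint)
  also have "\<dots> = (\<Sum>k=1..n. card (?L k))"
  proof (rule card_UN_disjoint)
    show "\<forall>i\<in>{1..n}. \<forall>j\<in>{1..n}. i \<noteq> j \<longrightarrow> ?L i \<inter> ?L j = {}"
    proof (intro ballI impI)
      fix i j :: nat assume "i \<in> {1..n}" "j \<in> {1..n}" "i \<noteq> j"
      \<comment> \<open>The smaller index is a strong fixed point in its own class but is forbidden
        in the class of the larger one.\<close>
      then have "i \<in> {1..<j} \<or> j \<in> {1..<i}" by auto
      then show "?L i \<inter> ?L j = {}" by blast
    qed
  qed (auto intro: finite_subset[OF _ fin])
  finally have "int (g n 1) = (\<Sum>k=1..n. int (card (?L k)))"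
    by simp
  also have "\<dots> = (\<Sum>k=1..n. fact (n - k) * f10 (k - 1))"
    by (intro sum.cong refl)
      (simp only: card_least_strong_fixpoint f10_eq_card_no_strong_fixpoint of_nat_mult of_nat_fact)
  finally show "int (g n 1) = (\<Sum>k=1..n. fact (n - k) * f10 (k - 1))" .
qed

end
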